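(* $(\mathrm{FFT},\mathrm{destruct})$ is a final $\mathcal{T}$-coalgebra: for every coalgebra $(C,\alpha)$ with $\alpha:C\to\mathcal{T}(C)$ there exists exactly one function $f:C\to\mathrm{FFT}$ with $\mathrm{destruct}\circ f=\mathcal{T}(f)\circ\alpha$.
   Context: Words are finite sequences of natural numbers; $\mathbb{N}^*$ is the set of words, $\epsilon$ the empty word, $\mathbb{N}^+$ the nonempty words; concatenation is juxtaposition; $\sqsubseteq$ is the prefix order ($\sqsubset$ strict). A tree is a prefix-closed set of words (nodes) with a labelling function $\ell$; trees are finitely branching: each node $w$ has an arity $k$ with $wi$ a node iff $i<k$; leaves are $\sqsubseteq$-maximal nodes. Fix a set $A$ of labels and an object $*\notin A$. A finite tree with non-wellfounded leaves is a finite tree $\iota$ labelled in $A\cup\{*\}$ whose root is not labelled $*$ and whose $*$-labelled nodes are all leaves; $\mathrm{nwleaf}(\iota)$ is its set of $*$-labelled nodes; $\mathrm{NWT}$ is the set of such trees. The endofunctor $\mathcal{T}$ on the category of sets: $\mathcal{T}(X)=\{(\iota,\mu):\iota\in\mathrm{NWT},\ \mu:\mathrm{nwleaf}(\iota)\to X\}$ and $\mathcal{T}(f)(\iota,\mu)=(\iota,f\circ\mu)$. A set $F\subseteq\mathbb{N}^*$ has the fragmentation properties if it is finite, has a $\sqsubseteq$-minimum, and is convex (if $w,v\in F$ and $w\sqsubseteq u\sqsubseteq v$ then $u\in F$). A finite-fragmented tree is a pair $\pi=(\tau,\mathcal{F})$ where $\tau$ is a (possibly infinite, finitely branching) tree labelled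 in $A$ and $\mathcal{F}$ is a partition of its nodes into sets with the fragmentation properties; $\sim^\pi$ is the associated equivalence relation; $\mathrm{FFT}$ is the set of all finite-fragmented trees. $\mathrm{roots}(\pi)$ is the set of minima of the blocks of $\mathcal{F}$. For roots $w,v$: $w\lhd v$ iff $w\sqsubset v$ and there is no root $u$ with $w\sqsubset u\sqsubset v$. For $w\in\mathrm{roots}(\pi)$: the tree fragment $\mathrm{tf}(\pi,w)\in\mathrm{NWT}$ has node set $\{v\in\mathbb{N}^*: w\sim^\pi wv\}\cup\{u\in\mathbb{N}^+: w\lhd wu\}$, with label $\ell^\pi(wv)$ at $v$ if $w\sim^\pi wv$ and $*$ at $u$ if $w\lhd wu$; the subtree $\mathrm{st}(\pi,w)$ is the finite-fragmented tree with nodes $\{v: wv \text{ is a node of }\pi\}$, labels $v\mapsto\ell^\pi(wv)$, and $v\sim u$ iff $wv\sim^\pi wu$. $\mathrm{destruct}:\mathrm{FFT}\to\mathcal{T}(\mathrm{FFT})$ is $\pi\mapsto(\mathrm{tf}(\pi,\epsilon),\ w\mapsto\mathrm{st}(\pi,w))$. *)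

theory Defs
  imports Main "HOL-Library.Sublist" "HOL-Library.FuncSet" "HOL-Library.Disjoint_Sets"
begin

type_synonym word = "nat list"

text \<open>A labelled tree is the partial map sending each node to its label; its domain is the
  set of nodes.  Trees are nonempty: they contain the root \<open>[]\<close>.\<close>

type_synonym 'a ltree = "word \<rightharpoonup> 'a"

definition is_tree :: "'a set \<Rightarrow> 'a ltree \<Rightarrow> bool" where
  "is_tree A \<tau> \<longleftrightarrow>
     [] \<in> dom \<tau> \<and>
     (\<forall>w\<in>dom \<tau>. \<forall>v. prefix v w \<longrightarrow> v \<in> dom \<tau>) \<and>
     (\<forall>w\<in>dom \<tau>. \<exists>k. \<forall>i. w @ [i] \<in> dom \<tau> \<longleftrightarrow> i < k) \<and>
     ran \<tau> \<subseteq> A"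

definition leaves :: "'a ltree \<Rightarrow> word set" where
  "leaves \<tau> = {w \<in> dom \<tau>. \<not> (\<exists>v\<in>dom \<tau>. strict_prefix w v)}"

text \<open>\<open>Star\<close> is the extra object \<open>*\<close>, which lies outside \<open>A\<close> by construction.\<close>

datatype 'a slabel = Label 'a | Star

definition nwleaf :: "'a slabel ltree \<Rightarrow> word set" where
  "nwleaf \<iota> = {w. \<iota> w = Some Star}"

definition NWT :: "'a set \<Rightarrow> 'a slabel ltree set" where
  "NWT A = {\<iota>. is_tree (insert Star (Label ` A)) \<iota> \<and> finite (dom \<iota>) \<and>
                \<iota> [] \<noteq> Some Star \<and> nwleaf \<iota> \<subseteq> leaves \<iota>}"

text \<open>The endofunctor on objects and on functions.  Functions \<open>nwleaf \<iota> \<rightarrow> X\<close> are represented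
  by extensional functions, so that equality is equality on \<open>nwleaf \<iota>\<close>.\<close>

definition T_obj :: "'a set \<Rightarrow> 'x set \<Rightarrow> ('a slabel ltree \<times> (word \<Rightarrow> 'x)) set" where
  "T_obj A X = (SIGMA \<iota>:NWT A. nwleaf \<iota> \<rightarrow>\<^sub>E X)"

definition T_map ::
    "('x \<Rightarrow> 'y) \<Rightarrow> 'a slabel ltree \<times> (word \<Rightarrow> 'x) \<Rightarrow> 'a slabel ltree \<times> (word \<Rightarrow> 'y)" where
  "T_map f = (\<lambda>(\<iota>, \<mu>). (\<iota>, compose (nwleaf \<iota>) f \<mu>))"

definition fragmentation :: "word set \<Rightarrow> bool" where
  "fragmentation F \<longleftrightarrow>
     finite F \<and>
     (\<exists>m\<in>F. \<forall>v\<in>F. prefix m v) \<and>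
     (\<forall>w\<in>F. \<forall>v\<in>F. \<forall>u. prefix w u \<and> prefix u v \<longrightarrow> u \<in> F)"

type_synonym 'a fft = "'a ltree \<times> word set set"

definition FFT :: "'a set \<Rightarrow> 'a fft set" where
  "FFT A = {(\<tau>, \<F>). is_tree A \<tau> \<and> partition_on (dom \<tau>) \<F> \<and> (\<forall>F\<in>\<F>. fragmentation F)}"

definition sim :: "'a fft \<Rightarrow> word \<Rightarrow> word \<Rightarrow> bool" where
  "sim \<pi> w v \<longleftrightarrow> (\<exists>F\<in>snd \<pi>. w \<in> F \<and> v \<in> F)"

definition roots :: "'a fft \<Rightarrow> word set" where
  "roots \<pi> = {w. \<exists>F\<in>snd \<pi>. w \<in> F \<and> (\<forall>v\<in>F. prefix w v)}"

text \<open>The immediate-successor relation \<open>w \<lhd> v\<close> between roots.\<close>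

definition root_succ :: "'a fft \<Rightarrow> word \<Rightarrow> word \<Rightarrow> bool" where
  "root_succ \<pi> w v \<longleftrightarrow>
     w \<in> roots \<pi> \<and> v \<in> roots \<pi> \<and> strict_prefix w v \<and>
     \<not> (\<exists>u\<in>roots \<pi>. strict_prefix w u \<and> strict_prefix u v)"

definition tf :: "'a fft \<Rightarrow> word \<Rightarrow> 'a slabel ltree" where
  "tf \<pi> w = (\<lambda>v. if sim \<pi> w (w @ v) then map_option Label (fst \<pi> (w @ v))
                 else if v \<noteq> [] \<and> root_succ \<pi> w (w @ v) then Some Star
                 else None)"

definition st :: "'a fft \<Rightarrow> word \<Rightarrow> 'a fft" where
  "st \<pi> w = ((\<lambda>v. fst \<pi> (w @ v)),
             {v. w @ v \<in> dom (fst \<pi>)} // {(v, u). sim \<pi> (w @ v) (w @ u)})"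

definition destruct :: "'a fft \<Rightarrow> 'a slabel ltree \<times> (word \<Rightarrow> 'a fft)" where
  "destruct \<pi> = (tf \<pi> [], \<lambda>w\<in>nwleaf (tf \<pi> []). st \<pi> w)"

definition T_coalgebra ::
    "'a set \<Rightarrow> 'c set \<Rightarrow> ('c \<Rightarrow> 'a slabel ltree \<times> (word \<Rightarrow> 'c)) \<Rightarrow> bool" where
  "T_coalgebra A C \<alpha> \<longleftrightarrow> \<alpha> \<in> C \<rightarrow> T_obj A C"

text \<open>Morphisms are extensional on the carrier, so that uniqueness is uniqueness as a
  function on \<open>C\<close>.\<close>

definition T_coalgebra_hom ::
    "'c set \<Rightarrow> ('c \<Rightarrow> 'a slabel ltree \<times> (word \<Rightarrow> 'c)) \<Rightarrow>
     'd set \<Rightarrow> ('d \<Rightarrow> 'a slabel ltree \<times> (word \<Rightarrow> 'd)) \<Rightarrow> ('c \<Rightarrow> 'd) \<Rightarrow> bool" where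
  "T_coalgebra_hom C \<alpha> D \<beta> f \<longleftrightarrow>
     f \<in> C \<rightarrow>\<^sub>E D \<and> (\<forall>c\<in>C. \<beta> (f c) = T_map f (\<alpha> c))"

end

(* A finite-fragmented tree is determined by its labels and its equivalence relation.  At a word
   outside the root fragment both are given by the subtree at a Star leaf above it, at a strictly
   shorter word since the root is not a Star; so bisimilar trees agree by induction on the length
   of the word, which gives uniqueness.  For existence, a coalgebra is run along words as a
   deterministic automaton; each time it enters a new fragment a block of the partition starts. *)

theory Submission
  imports Defs
begin

section \<open>Finite-fragmented trees through their equivalence relation\<close>

text \<open>What makes the root fragment separable from the rest is that roots cut cleanly: each
  block is convex with a unique minimum, so no block contains both a word extending a root
  \<open>u\<close> and a word not extending it. Passing to a subtree at a root therefore keeps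
  blocks whole. For the unfolding, the obstacle is that the coalgebra element reached by a run does
  not identify a block: the same element may be entered at many different words. Blocks are
  therefore indexed by the prefix at which the current fragment was entered. Finiteness and
  convexity of such a block come from the fragment being a finite tree whose \<open>Star\<close>
  nodes are leaves.\<close>

lemma is_tree_prefix: "is_tree A \<tau> \<Longrightarrow> w @ v \<in> dom \<tau> \<Longrightarrow> w \<in> dom \<tau>"
  unfolding is_tree_def by (metis prefixI)

text \<open>A partition is the quotient by its own equivalence, so later arguments can use
  \<open>sim\<close> and return to blocks only for finiteness, minima and convexity.\<close>

lemma FFT_D:
  assumes "\<pi> \<in> FFT A"
  shows FFT_is_tree: "is_tree A (fst \<pi>)"
    and FFT_equiv: "equiv (dom (fst \<pi>)) {(v, u). sim \<pi> v u}"
    and FFT_blocks: "snd \<pi> = dom (fst \<pi>) // {(v, u). sim \<pi> v u}"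
    and FFT_fragmentation: "F \<in> snd \<pi> \<Longrightarrow> fragmentation F"
  using assms equiv_partition_on[of "dom (fst \<pi>)" "snd \<pi>"]
    partition_on_eq_quotient[of "dom (fst \<pi>)" "snd \<pi>"]
  by (auto simp: FFT_def sim_def)

lemma FFT_eqI:
  assumes "\<pi> \<in> FFT A" "\<rho> \<in> FFT A" "fst \<pi> = fst \<rho>"
    and "\<And>w v. sim \<pi> w v \<longleftrightarrow> sim \<rho> w v"
  shows "\<pi> = \<rho>"
  using assms FFT_blocks[OF assms(1)] FFT_blocks[OF assms(2)] by (simp add: prod_eq_iff)

lemma sim_quotient:
  assumes "equiv D r"
  shows "sim (\<tau>, D // r) w v \<longleftrightarrow> (w, v) \<in> r"
proof
  assume "sim (\<tau>, D // r) w v"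
  then show "(w, v) \<in> r"
    using quotient_eq_iff[OF assms] by (auto simp: sim_def)
next
  assume wv: "(w, v) \<in> r"
  then have "w \<in> D" "(w, w) \<in> r"
    using assms by (auto simp: equiv_def refl_on_def)
  then show "sim (\<tau>, D // r) w v"
    using wv quotientI[of w D r] by (auto simp: sim_def)
qed

text \<open>Subtrees and unfoldings both carry a partition given as a quotient; this reduces the
  fragmentation properties to conditions on the relation.\<close>

lemma FFT_quotientI:
  assumes "is_tree A \<tau>" and r: "equiv (dom \<tau>) r"
    and fin: "\<And>w. w \<in> dom \<tau> \<Longrightarrow> finite (r `` {w})"
    and min: "\<And>w. w \<in> dom \<tau> \<Longrightarrow> \<exists>m. (w, m) \<in> r \<and> (\<forall>v. (w, v) \<in> r \<longrightarrow> prefix m v)"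
    and conv: "\<And>w u v. (w, v) \<in> r \<Longrightarrow> prefix w u \<Longrightarrow> prefix u v \<Longrightarrow> (w, u) \<in> r"
  shows "(\<tau>, dom \<tau> // r) \<in> FFT A"
proof -
  have "fragmentation F" if "F \<in> dom \<tau> // r" for F
  proof -
    from that obtain w where w: "w \<in> dom \<tau>" "F = r `` {w}" by (rule quotientE)
    \<comment> \<open>\<open>conv\<close> starts from a related pair; two members of the class of
      \<open>w\<close> are related to each other through \<open>w\<close>.\<close>
    have conv_F: "u \<in> F" if "x \<in> F" "y \<in> F" "prefix x u" "prefix u y" for x y u
    proof -
      have "sym r" "trans r" using r by (auto simp: equiv_def)
      then have "(x, y) \<in> r" using that w by (blast dest: symD transD)
      then have "(x, u) \<in> r" using conv that by blast
      then show ?thesis using that w \<open>trans r\<close> by (blast dest: transD)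
    qed
    obtain m where m: "(w, m) \<in> r" "\<forall>v. (w, v) \<in> r \<longrightarrow> prefix m v"
      using min[OF w(1)] by blast
    show ?thesis
      unfolding fragmentation_def
    proof (intro conjI ballI allI impI)
      show "finite F" using fin w by simp
      show "\<exists>m\<in>F. \<forall>v\<in>F. prefix m v" using m w by blast
    qed (use conv_F in blast)
  qed
  then show ?thesis using assms(1) partition_on_quotient[OF r] by (auto simp: FFT_def)
qed

section \<open>Blocks and roots of a fixed finite-fragmented tree\<close>

context
  fixes A :: "'a set" and \<pi> :: "'a fft"
  assumes \<pi>: "\<pi> \<in> FFT A"
begin

lemma Nil_in_dom: "[] \<in> dom (fst \<pi>)"
  using FFT_is_tree[OF \<pi>] by (simp add: is_tree_def)

lemma dom_append: "w @ v \<in> dom (fst \<pi>) \<Longrightarrow> w \<in> dom (fst \<pi>)"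
  using is_tree_prefix[OF FFT_is_tree[OF \<pi>]] .

lemma sim_in_dom: "sim \<pi> w v \<Longrightarrow> w \<in> dom (fst \<pi>) \<and> v \<in> dom (fst \<pi>)"
  using FFT_equiv[OF \<pi>] by (auto simp: equiv_def)

lemma sim_refl: "w \<in> dom (fst \<pi>) \<Longrightarrow> sim \<pi> w w"
  using FFT_equiv[OF \<pi>] by (auto simp: equiv_def refl_on_def)

lemma sim_sym: "sim \<pi> w v \<Longrightarrow> sim \<pi> v w"
  by (auto simp: sim_def)

lemma sim_trans: "sim \<pi> w v \<Longrightarrow> sim \<pi> v u \<Longrightarrow> sim \<pi> w u"
  using FFT_equiv[OF \<pi>] unfolding equiv_def trans_def by blast

lemma sim_block:
  assumes F: "F \<in> snd \<pi>" "w \<in> F"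
  shows "F = {v. sim \<pi> w v}"
proof -
  have "F \<in> dom (fst \<pi>) // {(v, u). sim \<pi> v u}" using F FFT_blocks[OF \<pi>] by simp
  then have "v \<in> F" if "sim \<pi> w v" for v
    using that F(2) in_quotient_imp_closed[OF FFT_equiv[OF \<pi>]] by blast
  with F show ?thesis by (auto simp: sim_def)
qed

lemma block_ex: "w \<in> dom (fst \<pi>) \<Longrightarrow> {v. sim \<pi> w v} \<in> snd \<pi>"
  using sim_refl sim_block by (metis sim_def)

lemma sim_finite: "finite {v. sim \<pi> w v}"
proof (cases "w \<in> dom (fst \<pi>)")
  case True
  then show ?thesis using FFT_fragmentation[OF \<pi> block_ex] by (auto simp: fragmentation_def)
next
  case False
  then have "{v. sim \<pi> w v} = {}" using sim_in_dom by auto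
  then show ?thesis by simp
qed

lemma sim_convex:
  assumes "sim \<pi> w v" "prefix w u" "prefix u v"
  shows "sim \<pi> w u"
proof -
  have w: "w \<in> dom (fst \<pi>)" using sim_in_dom assms by blast
  then show ?thesis
    using FFT_fragmentation[OF \<pi> block_ex[OF w]] assms sim_refl[OF w]
    unfolding fragmentation_def by blast
qed

lemma roots_iff: "w \<in> roots \<pi> \<longleftrightarrow> w \<in> dom (fst \<pi>) \<and> (\<forall>v. sim \<pi> w v \<longrightarrow> prefix w v)"
proof
  assume "w \<in> roots \<pi>"
  then obtain F where F: "F \<in> snd \<pi>" "w \<in> F" "\<forall>v\<in>F. prefix w v" by (auto simp: roots_def)
  have "v \<in> F" if "sim \<pi> w v" for v
    using that sim_block[OF F(1,2)] by (metis mem_Collect_eq)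
  moreover have "sim \<pi> w w" using F by (auto simp: sim_def)
  ultimately show "w \<in> dom (fst \<pi>) \<and> (\<forall>v. sim \<pi> w v \<longrightarrow> prefix w v)"
    using F(3) sim_in_dom by blast
next
  assume w: "w \<in> dom (fst \<pi>) \<and> (\<forall>v. sim \<pi> w v \<longrightarrow> prefix w v)"
  then show "w \<in> roots \<pi>" using block_ex[of w] sim_refl[of w] unfolding roots_def
    by (intro CollectI bexI[of _ "{v. sim \<pi> w v}"]) auto
qed

lemma Nil_root: "[] \<in> roots \<pi>"
  using Nil_in_dom by (simp add: roots_iff)

lemma sim_root_ex:
  assumes "w \<in> dom (fst \<pi>)"
  obtains m where "m \<in> roots \<pi>" "sim \<pi> m w" "prefix m w"
proof -
  obtain m where "sim \<pi> w m" "\<forall>v. sim \<pi> w v \<longrightarrow> prefix m v"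
    using FFT_fragmentation[OF \<pi> block_ex[OF assms]] unfolding fragmentation_def by blast
  moreover from this have "m \<in> roots \<pi>" "prefix m w"
    using sim_in_dom sim_trans sim_refl[OF assms] unfolding roots_iff by blast+
  ultimately show ?thesis using that sim_sym by blast
qed

lemma sim_roots_eq: "w \<in> roots \<pi> \<Longrightarrow> v \<in> roots \<pi> \<Longrightarrow> sim \<pi> w v \<Longrightarrow> w = v"
  by (meson prefix_order.antisym roots_iff sim_sym)

section \<open>The root fragment and the subtrees below it\<close>

lemma root_succ_Nil_iff:
  "root_succ \<pi> [] w \<longleftrightarrow> w \<in> roots \<pi> \<and> w \<noteq> [] \<and>
     \<not> (\<exists>u\<in>roots \<pi>. u \<noteq> [] \<and> strict_prefix u w)"
  using Nil_root by (auto simp: root_succ_def strict_prefix_def)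

text \<open>Let \<open>m\<close> be the root of the block of \<open>u @ v\<close>. Both
  \<open>m\<close> and \<open>u\<close> are prefixes of \<open>u @ v\<close>, hence comparable. If
  \<open>m\<close> is a prefix of \<open>u\<close>, convexity puts \<open>u\<close> into the block
  of \<open>m\<close>, and two roots in one block are equal. So \<open>u\<close> is a prefix of
  \<open>m\<close> in either case, and \<open>m\<close> is a prefix of the whole block.\<close>

lemma sim_above_root:
  assumes u: "u \<in> roots \<pi>" and s: "sim \<pi> (u @ v) w"
  shows "prefix u w"
proof -
  obtain m where m: "m \<in> roots \<pi>" "sim \<pi> m (u @ v)" "prefix m (u @ v)"
    using sim_root_ex sim_in_dom[OF s] by blast
  have "prefix u m"
  proof (cases "prefix m u")
    case True
    then have "sim \<pi> m u" using sim_convex[OF m(2)] by simp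
    then show ?thesis using sim_roots_eq m u by blast
  next
    case False
    then show ?thesis using m(3) by (meson prefix_same_cases prefixI)
  qed
  moreover have "prefix m w" using m s sim_trans roots_iff by blast
  ultimately show ?thesis by (rule prefix_order.trans)
qed

lemma tf_Star_iff: "tf \<pi> [] w = Some Star \<longleftrightarrow> root_succ \<pi> [] w"
proof
  assume "root_succ \<pi> [] w"
  moreover from this have "\<not> sim \<pi> [] w"
    using sim_roots_eq[OF Nil_root, of w] by (auto simp: root_succ_Nil_iff)
  ultimately show "tf \<pi> [] w = Some Star" by (auto simp: tf_def root_succ_Nil_iff)
qed (auto simp: tf_def split: if_splits)

lemma tf_Label_iff: "tf \<pi> [] w = Some (Label a) \<longleftrightarrow> sim \<pi> [] w \<and> fst \<pi> w = Some a"
  by (auto simp: tf_def)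

lemma tf_dom_iff: "w \<in> dom (tf \<pi> []) \<longleftrightarrow> sim \<pi> [] w \<or> root_succ \<pi> [] w"
  using sim_in_dom[of "[]" w] by (auto simp: tf_def root_succ_Nil_iff split: if_splits)

text \<open>Take \<open>u\<close> to be the shortest nonempty root that is a prefix of
  \<open>w\<close>. One exists because the root of the block of \<open>w\<close> is not
  \<open>[]\<close>, and minimal length excludes any root strictly between \<open>[]\<close> and
  \<open>u\<close>.\<close>

lemma not_sim_Nil_decomp:
  assumes w: "w \<in> dom (fst \<pi>)" and n: "\<not> sim \<pi> [] w"
  obtains u v where "w = u @ v" "root_succ \<pi> [] u"
proof -
  let ?P = "\<lambda>u. u \<in> roots \<pi> \<and> u \<noteq> [] \<and> prefix u w"
  obtain m where "m \<in> roots \<pi>" "sim \<pi> m w" "prefix m w" using sim_root_ex[OF w] by blast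
  with n have "?P m" by auto
  then obtain u where u: "?P u" and least: "\<And>x. ?P x \<Longrightarrow> length u \<le> length x"
    using arg_min_nat_lemma[of ?P m length] by blast
  have "\<not> strict_prefix x u" if "x \<in> roots \<pi>" "x \<noteq> []" for x
    using least[of x] that u prefix_length_less[of x u]
    by (meson leD prefix_order.less_imp_le prefix_order.trans)
  with u have "root_succ \<pi> [] u" by (auto simp: root_succ_Nil_iff)
  with u show ?thesis using that by (auto elim: prefixE)
qed

lemma root_succ_not_sim:
  assumes "root_succ \<pi> [] u" shows "\<not> sim \<pi> [] (u @ v)"
proof
  assume "sim \<pi> [] (u @ v)"
  then have "sim \<pi> [] u" using sim_convex by simp
  then show False using sim_roots_eq[OF Nil_root, of u] assms by (auto simp: root_succ_Nil_iff)
qed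

lemma root_succ_leaf:
  assumes u: "root_succ \<pi> [] u" and w: "strict_prefix u w"
  shows "w \<notin> dom (tf \<pi> [])"
proof -
  obtain v where "w = u @ v" using w by (auto simp: strict_prefix_def elim: prefixE)
  then have "\<not> sim \<pi> [] w" using root_succ_not_sim[OF u] by blast
  moreover have "\<not> root_succ \<pi> [] w" using u w by (auto simp: root_succ_Nil_iff)
  ultimately show ?thesis by (simp add: tf_dom_iff)
qed

lemma sim_Nil_if_below_root_succ:
  assumes "root_succ \<pi> [] u" "strict_prefix w u"
  shows "sim \<pi> [] w"
proof (rule ccontr)
  assume n: "\<not> sim \<pi> [] w"
  have "w \<in> dom (fst \<pi>)"
    using assms dom_append by (metis prefixE root_succ_Nil_iff roots_iff strict_prefix_def)
  then obtain x y where "w = x @ y" "root_succ \<pi> [] x" using not_sim_Nil_decomp n by blast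
  with assms show False
    by (auto simp: root_succ_Nil_iff) (meson prefixI prefix_order.le_less_trans)
qed

text \<open>Cutting at the root fragment does not change the arity of its nodes: a child that leaves
  the block must itself be a \<open>Star\<close> leaf, since a cut any higher would already separate
  \<open>w\<close> from the root.\<close>

lemma tf_children:
  assumes w: "sim \<pi> [] w"
  shows "w @ [i] \<in> dom (tf \<pi> []) \<longleftrightarrow> w @ [i] \<in> dom (fst \<pi>)"
proof
  assume "w @ [i] \<in> dom (tf \<pi> [])"
  then show "w @ [i] \<in> dom (fst \<pi>)"
    using sim_in_dom[of "[]"] unfolding tf_dom_iff root_succ_Nil_iff roots_iff by blast
next
  assume d: "w @ [i] \<in> dom (fst \<pi>)"
  show "w @ [i] \<in> dom (tf \<pi> [])"
  proof (cases "sim \<pi> [] (w @ [i])")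
    case False
    with d obtain u v where uv: "w @ [i] = u @ v" "root_succ \<pi> [] u"
      using not_sim_Nil_decomp by blast
    have "v = []"
    proof (rule ccontr)
      assume "v \<noteq> []"
      then have "w = u @ butlast v" using uv(1) by (metis butlast_append butlast_snoc)
      then show False using w root_succ_not_sim[OF uv(2)] by blast
    qed
    then show ?thesis using uv by (simp add: tf_dom_iff)
  qed (simp add: tf_dom_iff)
qed

lemma tf_in_NWT: "tf \<pi> [] \<in> NWT A"
proof -
  let ?t = "tf \<pi> []"
  have branch: "\<exists>k. \<forall>i. w @ [i] \<in> dom (fst \<pi>) \<longleftrightarrow> i < k" if "w \<in> dom (fst \<pi>)" for w
    using FFT_is_tree[OF \<pi>] that by (simp add: is_tree_def)
  have ran: "ran (fst \<pi>) \<subseteq> A" using FFT_is_tree[OF \<pi>] by (simp add: is_tree_def)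
  have root: "sim \<pi> [] []" using sim_refl Nil_in_dom by blast
  have "v \<in> dom ?t" if "w \<in> dom ?t" "prefix v w" for v w
  proof (cases "sim \<pi> [] w")
    case True
    then show ?thesis using sim_convex that by (simp add: tf_dom_iff)
  next
    case False
    with that have "root_succ \<pi> [] w" by (simp add: tf_dom_iff)
    then show ?thesis using that sim_Nil_if_below_root_succ[of w v]
      by (auto simp: tf_dom_iff strict_prefix_def)
  qed
  moreover have "\<exists>k. \<forall>i. w @ [i] \<in> dom ?t \<longleftrightarrow> i < k" if w: "w \<in> dom ?t" for w
  proof (cases "sim \<pi> [] w")
    case True
    then show ?thesis using tf_children branch sim_in_dom by simp
  next
    case False
    with w have "root_succ \<pi> [] w" by (simp add: tf_dom_iff)
    then have "\<forall>i. w @ [i] \<notin> dom ?t" using root_succ_leaf by (simp add: strict_prefix_def)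
    then show ?thesis by (intro exI[of _ 0]) simp
  qed
  moreover have "ran ?t \<subseteq> insert Star (Label ` A)"
    using ran by (auto simp: ran_def tf_def split: if_splits)
  ultimately have tree: "is_tree (insert Star (Label ` A)) ?t"
    using root unfolding is_tree_def by (auto simp: tf_dom_iff)
  \<comment> \<open>Every \<open>Star\<close> leaf is a child of a node in the root block, which is
    finite and finitely branching.\<close>
  have "finite (dom ?t)"
  proof -
    let ?S = "{v. sim \<pi> [] v}"
    have parent: "\<exists>w\<in>?S. \<exists>i. u = w @ [i] \<and> w @ [i] \<in> dom (fst \<pi>)"
      if u: "root_succ \<pi> [] u" for u
    proof -
      have "u \<noteq> []" "u \<in> dom (fst \<pi>)" using u unfolding root_succ_Nil_iff roots_iff by auto
      then obtain w i where wi: "u = w @ [i]" by (metis rev_exhaust)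
      then have "sim \<pi> [] w" using sim_Nil_if_below_root_succ[OF u] by (simp add: strict_prefix_def)
      with wi \<open>u \<in> dom (fst \<pi>)\<close> show ?thesis by blast
    qed
    have sub: "dom ?t \<subseteq> ?S \<union> (\<Union>w\<in>?S. (\<lambda>i. w @ [i]) ` {i. w @ [i] \<in> dom (fst \<pi>)})"
    proof
      fix u assume "u \<in> dom ?t"
      then consider "u \<in> ?S" | "root_succ \<pi> [] u" unfolding tf_dom_iff by blast
      then show "u \<in> ?S \<union> (\<Union>w\<in>?S. (\<lambda>i. w @ [i]) ` {i. w @ [i] \<in> dom (fst \<pi>)})"
      proof cases
        case 2
        then show ?thesis using parent[of u] by blast
      qed blast
    qed
    have "finite {i. w @ [i] \<in> dom (fst \<pi>)}" if "w \<in> ?S" for w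
    proof -
      have "w \<in> dom (fst \<pi>)" using that sim_in_dom by simp
      then obtain k where "\<forall>i. w @ [i] \<in> dom (fst \<pi>) \<longleftrightarrow> i < k" using branch by blast
      then have "{i. w @ [i] \<in> dom (fst \<pi>)} = {..<k}" by auto
      then show ?thesis by simp
    qed
    then show ?thesis by (intro finite_subset[OF sub] finite_UnI finite_UN_I sim_finite) auto
  qed
  moreover have "?t [] \<noteq> Some Star" by (simp add: tf_Star_iff root_succ_Nil_iff)
  moreover have "w \<in> leaves ?t" if "w \<in> nwleaf ?t" for w
  proof -
    from that have w: "root_succ \<pi> [] w" by (simp add: nwleaf_def tf_Star_iff)
    then have "w \<in> dom ?t" by (simp add: tf_dom_iff)
    with root_succ_leaf[OF w] show ?thesis unfolding leaves_def by blast
  qed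
  ultimately show ?thesis using tree by (auto simp: NWT_def)
qed

section \<open>Subtrees at roots are finite-fragmented trees\<close>

lemma st_equiv:
  "equiv (dom (fst (st \<pi> w))) {(v, u). sim \<pi> (w @ v) (w @ u)}"
proof (rule equivI)
  show "{(v, u). sim \<pi> (w @ v) (w @ u)} \<subseteq> dom (fst (st \<pi> w)) \<times> dom (fst (st \<pi> w))"
    using sim_in_dom by (fastforce simp: st_def dom_def)
  show "refl_on (dom (fst (st \<pi> w))) {(v, u). sim \<pi> (w @ v) (w @ u)}"
    using sim_refl by (auto simp: refl_on_def st_def)
  show "sym {(v, u). sim \<pi> (w @ v) (w @ u)}"
    using sim_sym by (auto simp: sym_def)
  show "trans {(v, u). sim \<pi> (w @ v) (w @ u)}"
    using sim_trans unfolding trans_def by blast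
qed

lemma st_eq: "st \<pi> w = (fst (st \<pi> w), dom (fst (st \<pi> w)) // {(v, u). sim \<pi> (w @ v) (w @ u)})"
  by (simp add: st_def dom_def)

lemma sim_st: "sim (st \<pi> w) v u \<longleftrightarrow> sim \<pi> (w @ v) (w @ u)"
  using sim_quotient[OF st_equiv[of w], of "fst (st \<pi> w)"] st_eq[of w] by auto

lemma fst_st: "fst (st \<pi> w) v = fst \<pi> (w @ v)"
  by (simp add: st_def)

lemma st_in_FFT:
  assumes w: "w \<in> roots \<pi>"
  shows "st \<pi> w \<in> FFT A"
proof -
  have dom_st: "v \<in> dom (fst (st \<pi> w)) \<longleftrightarrow> w @ v \<in> dom (fst \<pi>)" for v
    by (simp add: st_def dom_def)
  have t: "is_tree A (fst \<pi>)" by (rule FFT_is_tree[OF \<pi>])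
  have "is_tree A (fst (st \<pi> w))"
    unfolding is_tree_def
  proof (intro conjI ballI allI impI)
    show "[] \<in> dom (fst (st \<pi> w))" using w by (simp add: dom_st roots_iff)
    show "v \<in> dom (fst (st \<pi> w))" if "x \<in> dom (fst (st \<pi> w))" "prefix v x" for x v
      using that dom_append[of "w @ v"] by (auto simp: dom_st elim!: prefixE)
    show "\<exists>k. \<forall>i. x @ [i] \<in> dom (fst (st \<pi> w)) \<longleftrightarrow> i < k" if "x \<in> dom (fst (st \<pi> w))" for x
    proof -
      have "\<exists>k. \<forall>i. (w @ x) @ [i] \<in> dom (fst \<pi>) \<longleftrightarrow> i < k"
        using that t unfolding dom_st is_tree_def by blast
      then show ?thesis by (simp add: dom_st)
    qed
    show "ran (fst (st \<pi> w)) \<subseteq> A"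
      using t by (auto simp: is_tree_def ran_def fst_st)
  qed
  then have "(fst (st \<pi> w), dom (fst (st \<pi> w)) // {(v, u). sim \<pi> (w @ v) (w @ u)}) \<in> FFT A"
  proof (rule FFT_quotientI[OF _ st_equiv])
    fix v assume "v \<in> dom (fst (st \<pi> w))"
    then have v: "w @ v \<in> dom (fst \<pi>)" by (simp add: dom_st)
    have "finite ((@) w -` {u. sim \<pi> (w @ v) u})"
      by (intro finite_vimageI sim_finite) (simp add: inj_def)
    then show "finite ({(v, u). sim \<pi> (w @ v) (w @ u)} `` {v})"
      by (rule rev_finite_subset) auto
    obtain m where m: "m \<in> roots \<pi>" "sim \<pi> m (w @ v)" using sim_root_ex[OF v] by blast
    \<comment> \<open>The block of \<open>w @ v\<close> has its minimum inside the subtree because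
      \<open>w\<close> is a root; deleting \<open>w\<close> from it gives the witness.\<close>
    then have "prefix w m" using sim_above_root[OF w] sim_sym by blast
    then obtain m' where "m = w @ m'" by (auto elim: prefixE)
    moreover from m have "\<forall>u. sim \<pi> (w @ v) u \<longrightarrow> prefix m u" "sim \<pi> (w @ v) m"
      using sim_sym sim_trans roots_iff by blast+
    ultimately show "\<exists>m. (v, m) \<in> {(v, u). sim \<pi> (w @ v) (w @ u)} \<and>
        (\<forall>u. (v, u) \<in> {(v, u). sim \<pi> (w @ v) (w @ u)} \<longrightarrow> prefix m u)"
      using \<open>m = w @ m'\<close> by (intro exI[of _ m']) (auto dest: spec[of _ "w @ _"])
  next
    fix x y z assume "(x, z) \<in> {(v, u). sim \<pi> (w @ v) (w @ u)}" "prefix x y" "prefix y z"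
    then show "(x, y) \<in> {(v, u). sim \<pi> (w @ v) (w @ u)}"
      using sim_convex[of "w @ x" "w @ z" "w @ y"] by simp
  qed
  then show ?thesis using st_eq[of w] by simp
qed

lemma destruct_in_T_obj: "destruct \<pi> \<in> T_obj A (FFT A)"
  using tf_in_NWT st_in_FFT
  by (auto simp: destruct_def T_obj_def nwleaf_def tf_Star_iff root_succ_Nil_iff)

end


section \<open>Uniqueness by coinduction\<close>

text \<open>Only inclusions are proved, so that the other direction follows by applying the result
  to the converse relation. The induction follows \<open>w\<close> alone: whenever \<open>w\<close>
  lies in a subtree at a root, \<open>sim_above_root\<close> carries \<open>w'\<close> into the same
  subtree.\<close>

lemma FFT_bisim_le:
  fixes R :: "'a fft \<Rightarrow> 'a fft \<Rightarrow> bool"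
  assumes FFT: "\<And>\<pi> \<rho>. R \<pi> \<rho> \<Longrightarrow> \<pi> \<in> FFT A \<and> \<rho> \<in> FFT A"
    and tf: "\<And>\<pi> \<rho>. R \<pi> \<rho> \<Longrightarrow> tf \<pi> [] = tf \<rho> []"
    and st: "\<And>\<pi> \<rho> u. R \<pi> \<rho> \<Longrightarrow> tf \<pi> [] u = Some Star \<Longrightarrow> R (st \<pi> u) (st \<rho> u)"
    and "R \<pi> \<rho>"
  shows "(fst \<pi> w = Some a \<longrightarrow> fst \<rho> w = Some a) \<and> (sim \<pi> w w' \<longrightarrow> sim \<rho> w w')"
  using \<open>R \<pi> \<rho>\<close>
proof (induction w arbitrary: \<pi> \<rho> w' rule: measure_induct_rule[of length])
  case (less w)
  from less.prems have \<pi>: "\<pi> \<in> FFT A" and \<rho>: "\<rho> \<in> FFT A" using FFT by auto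
  have frag: "sim \<rho> [] v \<and> fst \<rho> v = fst \<pi> v" if v: "sim \<pi> [] v" for v
  proof -
    obtain b where b: "fst \<pi> v = Some b" using sim_in_dom[OF \<pi> v] by auto
    with v have "tf \<pi> [] v = Some (Label b)" by (simp add: tf_Label_iff[OF \<pi>])
    then have "tf \<rho> [] v = Some (Label b)" using tf[OF less.prems] by simp
    with b show ?thesis by (simp add: tf_Label_iff[OF \<rho>])
  qed
  consider "w \<notin> dom (fst \<pi>)" | "sim \<pi> [] w" | "w \<in> dom (fst \<pi>)" "\<not> sim \<pi> [] w" by blast
  then show ?case
  proof cases
    case 1
    then show ?thesis using sim_in_dom[OF \<pi>, of w w'] by auto
  next
    case 2
    \<comment> \<open>Both words lie in the root block of \<open>\<pi>\<close>, hence in that of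
      \<open>\<rho>\<close>, where they are linked through \<open>[]\<close>.\<close>
    have "sim \<rho> w w'" if "sim \<pi> w w'"
      using frag[OF 2] frag[OF sim_trans[OF \<pi> 2 that]] sim_sym sim_trans[OF \<rho>] \<rho> by blast
    with frag[OF 2] show ?thesis by simp
  next
    case 3
    then obtain u v where w: "w = u @ v" and u: "root_succ \<pi> [] u"
      using not_sim_Nil_decomp[OF \<pi>] by blast
    then have "length v < length w" and root: "u \<in> roots \<pi>"
      by (simp_all add: root_succ_Nil_iff[OF \<pi>])
    moreover have "R (st \<pi> u) (st \<rho> u)" using st[OF less.prems] u by (simp add: tf_Star_iff[OF \<pi>])
    ultimately have IH: "(fst (st \<pi> u) v = Some a \<longrightarrow> fst (st \<rho> u) v = Some a) \<and>
        (sim (st \<pi> u) v v' \<longrightarrow> sim (st \<rho> u) v v')" for v'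
      using less.IH by blast
    have "sim \<rho> w w'" if s: "sim \<pi> w w'"
    proof -
      obtain v' where "w' = u @ v'"
        using sim_above_root[OF \<pi> root, of v w'] s w by (auto elim: prefixE)
      then show ?thesis using IH s w by (simp add: sim_st[OF \<pi>] sim_st[OF \<rho>])
    qed
    then show ?thesis using IH w by (simp add: fst_st[OF \<pi>] fst_st[OF \<rho>])
  qed
qed

text \<open>The converse of \<open>R\<close> satisfies the same closure conditions, because related
  trees have the same root fragment and hence the same \<open>Star\<close> leaves.\<close>

lemma FFT_coinduct:
  fixes R :: "'a fft \<Rightarrow> 'a fft \<Rightarrow> bool"
  assumes "R \<pi> \<rho>"
    and FFT: "\<And>\<pi> \<rho>. R \<pi> \<rho> \<Longrightarrow> \<pi> \<in> FFT A \<and> \<rho> \<in> FFT A"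
    and tf: "\<And>\<pi> \<rho>. R \<pi> \<rho> \<Longrightarrow> tf \<pi> [] = tf \<rho> []"
    and st: "\<And>\<pi> \<rho> u. R \<pi> \<rho> \<Longrightarrow> tf \<pi> [] u = Some Star \<Longrightarrow> R (st \<pi> u) (st \<rho> u)"
  shows "\<pi> = \<rho>"
proof -
  note le = FFT_bisim_le[of R, OF FFT tf st \<open>R \<pi> \<rho>\<close>]
  have "R\<inverse>\<inverse> \<rho> \<pi>" using \<open>R \<pi> \<rho>\<close> by simp
  have ge: "(fst \<rho> w = Some a \<longrightarrow> fst \<pi> w = Some a) \<and> (sim \<rho> w w' \<longrightarrow> sim \<pi> w w')" for w w' a
    by (rule FFT_bisim_le[of "R\<inverse>\<inverse>" A]) (use FFT tf st \<open>R \<pi> \<rho>\<close> in \<open>fastforce+\<close>)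
  have "fst \<pi> w = fst \<rho> w" for w
  proof (cases "fst \<pi> w")
    case None
    then show ?thesis using ge[of w _ w] by (cases "fst \<rho> w") auto
  next
    case (Some a)
    then show ?thesis using le[of w a w] by auto
  qed
  then show ?thesis
    using FFT_eqI[of \<pi> A \<rho>] FFT[OF \<open>R \<pi> \<rho>\<close>] le ge by blast
qed

section \<open>Existence by unfolding\<close>

text \<open>A coalgebra is run along a word: the state \<open>(c, v)\<close> says that the current fragment is
  that of \<open>c\<close> and that \<open>v\<close> is the position reached in it.  Entering a \<open>Star\<close> leaf
  switches to the fragment of its continuation.\<close>

definition step :: "('c \<Rightarrow> 'a slabel ltree \<times> (word \<Rightarrow> 'c)) \<Rightarrow> 'c \<times> word \<Rightarrow> nat \<Rightarrow> 'c \<times> word" where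
  "step \<alpha> = (\<lambda>(c, v) i. if fst (\<alpha> c) (v @ [i]) = Some Star then (snd (\<alpha> c) (v @ [i]), [])
                        else (c, v @ [i]))"

definition run :: "('c \<Rightarrow> 'a slabel ltree \<times> (word \<Rightarrow> 'c)) \<Rightarrow> 'c \<Rightarrow> word \<Rightarrow> 'c \<times> word" where
  "run \<alpha> c = foldl (step \<alpha>) (c, [])"

text \<open>Runs are total, so \<open>None\<close> marks words whose run has left the node set of
  its fragment. The case \<open>Star\<close> also yields \<open>None\<close>, but
  \<open>run_state\<close> shows that it does not arise from elements of the carrier.\<close>

definition unfold_tree :: "('c \<Rightarrow> 'a slabel ltree \<times> (word \<Rightarrow> 'c)) \<Rightarrow> 'c \<Rightarrow> 'a ltree" where
  "unfold_tree \<alpha> c w =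
     (case run \<alpha> c w of (d, v) \<Rightarrow> (case fst (\<alpha> d) v of Some (Label a) \<Rightarrow> Some a | _ \<Rightarrow> None))"

text \<open>The position reached in the current fragment is a suffix of \<open>w\<close>; removing
  it leaves the prefix at which that fragment was entered.\<close>

definition frag_root :: "('c \<Rightarrow> 'a slabel ltree \<times> (word \<Rightarrow> 'c)) \<Rightarrow> 'c \<Rightarrow> word \<Rightarrow> word" where
  "frag_root \<alpha> c w = take (length w - length (snd (run \<alpha> c w))) w"

definition unfold_rel :: "('c \<Rightarrow> 'a slabel ltree \<times> (word \<Rightarrow> 'c)) \<Rightarrow> 'c \<Rightarrow> (word \<times> word) set" where
  "unfold_rel \<alpha> c = {(w, v). w \<in> dom (unfold_tree \<alpha> c) \<and> v \<in> dom (unfold_tree \<alpha> c) \<and>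
                            frag_root \<alpha> c w = frag_root \<alpha> c v}"

definition unfold_fft :: "('c \<Rightarrow> 'a slabel ltree \<times> (word \<Rightarrow> 'c)) \<Rightarrow> 'c \<Rightarrow> 'a fft" where
  "unfold_fft \<alpha> c = (unfold_tree \<alpha> c, dom (unfold_tree \<alpha> c) // unfold_rel \<alpha> c)"

lemma run_Nil [simp]: "run \<alpha> c [] = (c, [])"
  by (simp add: run_def)

lemma run_snoc: "run \<alpha> c (w @ [i]) = step \<alpha> (run \<alpha> c w) i"
  by (simp add: run_def)

lemma run_append: "run \<alpha> c w = (d, []) \<Longrightarrow> run \<alpha> c (w @ v) = run \<alpha> d v"
  by (simp add: run_def)

text \<open>Invariant of the automaton: the position component is the part of the word read since
  the last switch, and the run on the remaining prefix ends exactly at that switch.\<close>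

lemma run_decomp: "\<exists>r. w = r @ snd (run \<alpha> c w) \<and> run \<alpha> c r = (fst (run \<alpha> c w), [])"
proof (induction w rule: rev_induct)
  case (snoc i w)
  then obtain r where r: "w = r @ snd (run \<alpha> c w)" "run \<alpha> c r = (fst (run \<alpha> c w), [])" by blast
  obtain d v where dv: "run \<alpha> c w = (d, v)" by fastforce
  show ?case
  proof (cases "fst (\<alpha> d) (v @ [i]) = Some Star")
    case True
    \<comment> \<open>The last letter triggers the switch, so the new fragment is entered at the
      full word.\<close>
    then show ?thesis by (intro exI[of _ "w @ [i]"]) (simp add: run_snoc dv step_def)
  next
    case False
    then have "run \<alpha> c (w @ [i]) = (d, v @ [i])" by (simp add: run_snoc dv step_def)
    moreover have "w @ [i] = r @ v @ [i]" "run \<alpha> c r = (d, [])" using r dv by auto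
    ultimately show ?thesis by (metis fst_conv snd_conv)
  qed
qed simp

lemma frag_root_run:
  assumes "run \<alpha> c w = (d, v)"
  shows "w = frag_root \<alpha> c w @ v" "run \<alpha> c (frag_root \<alpha> c w) = (d, [])"
proof -
  obtain r where r: "w = r @ v" "run \<alpha> c r = (d, [])" using run_decomp[of w \<alpha> c] assms by auto
  moreover from r(1) have "frag_root \<alpha> c w = r" unfolding frag_root_def using assms by simp
  ultimately show "w = frag_root \<alpha> c w @ v" "run \<alpha> c (frag_root \<alpha> c w) = (d, [])" by simp_all
qed

lemma frag_root_eqI: "run \<alpha> c (r @ v) = (d, v) \<Longrightarrow> frag_root \<alpha> c (r @ v) = r"
  by (simp add: frag_root_def)

lemma run_no_Star:
  assumes "\<And>u. u \<noteq> [] \<Longrightarrow> prefix u v \<Longrightarrow> fst (\<alpha> c) u \<noteq> Some Star"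
  shows "run \<alpha> c v = (c, v)"
  using assms
proof (induction v rule: rev_induct)
  case (snoc i v)
  then have "run \<alpha> c v = (c, v)" "fst (\<alpha> c) (v @ [i]) \<noteq> Some Star" by simp_all
  then show ?case by (simp add: run_snoc step_def)
qed simp

section \<open>Fragments of a coalgebra and the runs through them\<close>

context
  fixes A :: "'a set" and C :: "'c set" and \<alpha> :: "'c \<Rightarrow> 'a slabel ltree \<times> (word \<Rightarrow> 'c)"
  assumes \<alpha>: "T_coalgebra A C \<alpha>"
begin

lemma NWT_coalg: "c \<in> C \<Longrightarrow> fst (\<alpha> c) \<in> NWT A"
  using \<alpha> by (force simp: T_coalgebra_def T_obj_def)

lemma coalg_tree: "c \<in> C \<Longrightarrow> is_tree (insert Star (Label ` A)) (fst (\<alpha> c))"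
  using NWT_coalg by (simp add: NWT_def)

lemma coalg_Nil: "c \<in> C \<Longrightarrow> \<exists>a. fst (\<alpha> c) [] = Some (Label a)"
  using NWT_coalg[of c] coalg_tree[of c] unfolding NWT_def is_tree_def
  by (metis (mono_tags, lifting) domD mem_Collect_eq slabel.exhaust)

lemma coalg_Star_nonempty: "c \<in> C \<Longrightarrow> fst (\<alpha> c) u = Some Star \<Longrightarrow> u \<noteq> []"
  using coalg_Nil[of c] by auto

lemma coalg_Star: "c \<in> C \<Longrightarrow> fst (\<alpha> c) u = Some Star \<Longrightarrow> snd (\<alpha> c) u \<in> C"
  using \<alpha> by (fastforce simp: T_coalgebra_def T_obj_def nwleaf_def PiE_iff Pi_iff)

lemma coalg_Star_leaf:
  assumes "c \<in> C" "fst (\<alpha> c) u = Some Star" "strict_prefix u v"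
  shows "fst (\<alpha> c) v = None"
proof -
  have "u \<in> leaves (fst (\<alpha> c))" using NWT_coalg[OF assms(1)] assms(2) by (auto simp: NWT_def nwleaf_def)
  with assms(3) show ?thesis unfolding leaves_def by blast
qed

lemma coalg_below:
  assumes "c \<in> C" "fst (\<alpha> c) v = Some l" "strict_prefix u v"
  shows "\<exists>a. fst (\<alpha> c) u = Some (Label a)"
proof -
  have "u \<in> dom (fst (\<alpha> c))"
    using coalg_tree[OF assms(1)] assms unfolding is_tree_def strict_prefix_def by blast
  moreover have "fst (\<alpha> c) u \<noteq> Some Star" using coalg_Star_leaf[OF assms(1) _ assms(3)] assms(2) by auto
  ultimately show ?thesis by (metis domD slabel.exhaust)
qed

lemma run_Label:
  assumes "c \<in> C" "fst (\<alpha> c) v = Some (Label a)"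
  shows "run \<alpha> c v = (c, v)"
proof (rule run_no_Star)
  fix u assume "u \<noteq> []" "prefix u v"
  then show "fst (\<alpha> c) u \<noteq> Some Star"
    using coalg_below[OF assms(1,2), of u] assms(2) by (cases "u = v") (auto simp: strict_prefix_def)
qed

text \<open>All proper prefixes of a \<open>Star\<close> leaf carry labels, so the run stays in the
  fragment of \<open>c\<close> up to the parent of \<open>u\<close> and switches on the last
  letter.\<close>

lemma run_Star:
  assumes c: "c \<in> C" and u: "fst (\<alpha> c) u = Some Star"
  shows "run \<alpha> c (u @ v) = run \<alpha> (snd (\<alpha> c) u) v"
proof -
  obtain u' i where u': "u = u' @ [i]" using coalg_Star_nonempty[OF c u] by (metis rev_exhaust)
  obtain a where "fst (\<alpha> c) u' = Some (Label a)"
    using coalg_below[OF c u, of u'] u' by (auto simp: strict_prefix_def)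
  then have "run \<alpha> c u' = (c, u')" using run_Label c by blast
  then have "run \<alpha> c u = (snd (\<alpha> c) u, [])" using u u' by (simp add: run_snoc step_def)
  then show ?thesis by (rule run_append)
qed

text \<open>A \<open>Star\<close> is never a resting position: reaching one switches at once to the
  root of the next fragment, which is labelled in \<open>A\<close>.\<close>

lemma run_state:
  assumes "c \<in> C"
  shows "run \<alpha> c w = (d, v) \<Longrightarrow> d \<in> C \<and> fst (\<alpha> d) v \<noteq> Some Star"
proof (induction w arbitrary: d v rule: rev_induct)
  case Nil
  then show ?case using assms coalg_Nil by fastforce
next
  case (snoc i w)
  obtain d' v' where r: "run \<alpha> c w = (d', v')" by fastforce
  then have "d' \<in> C" using snoc.IH by blast
  then show ?case
    using snoc.prems coalg_Star coalg_Nil[of d] r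
    by (auto simp: run_snoc step_def split: if_splits)
qed

section \<open>The unfolding is a tree\<close>

lemma unfold_tree_Some_iff:
  "run \<alpha> c w = (d, v) \<Longrightarrow> unfold_tree \<alpha> c w = Some a \<longleftrightarrow> fst (\<alpha> d) v = Some (Label a)"
  by (auto simp: unfold_tree_def split: option.splits slabel.splits)

lemma unfold_tree_dom_iff:
  assumes "c \<in> C" "run \<alpha> c w = (d, v)"
  shows "w \<in> dom (unfold_tree \<alpha> c) \<longleftrightarrow> v \<in> dom (fst (\<alpha> d))"
  using run_state[OF assms] unfold_tree_Some_iff[OF assms(2)]
  by (cases "fst (\<alpha> d) v"; cases "the (fst (\<alpha> d) v)") (auto simp: dom_def)

text \<open>Arities are inherited from the fragments: a \<open>Star\<close> child is replaced by the
  root of its continuation, which is again a node.\<close>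

lemma unfold_tree_children:
  assumes c: "c \<in> C" and r: "run \<alpha> c w = (d, v)"
  shows "w @ [i] \<in> dom (unfold_tree \<alpha> c) \<longleftrightarrow> v @ [i] \<in> dom (fst (\<alpha> d))"
proof (cases "fst (\<alpha> d) (v @ [i]) = Some Star")
  case True
  then have r': "run \<alpha> c (w @ [i]) = (snd (\<alpha> d) (v @ [i]), [])" using r by (simp add: run_snoc step_def)
  then show ?thesis
    using True unfold_tree_dom_iff[OF c r'] run_state[OF c r'] coalg_Nil by fastforce
next
  case False
  then have "run \<alpha> c (w @ [i]) = (d, v @ [i])" using r by (simp add: run_snoc step_def)
  then show ?thesis using unfold_tree_dom_iff[OF c] by blast
qed

text \<open>A run that has left the node set of its fragment never comes back, because fragments are
  prefix-closed and so no \<open>Star\<close> can be met afterwards.\<close>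

lemma unfold_tree_append:
  assumes c: "c \<in> C"
  shows "w @ v \<in> dom (unfold_tree \<alpha> c) \<Longrightarrow> w \<in> dom (unfold_tree \<alpha> c)"
proof (induction v rule: rev_induct)
  case (snoc i v)
  obtain d x where r: "run \<alpha> c (w @ v) = (d, x)" by fastforce
  then have "x @ [i] \<in> dom (fst (\<alpha> d))" using unfold_tree_children[OF c r, of i] snoc.prems by simp
  then have "x \<in> dom (fst (\<alpha> d))" using is_tree_prefix coalg_tree run_state[OF c r] by blast
  then show ?case using unfold_tree_dom_iff[OF c r] snoc.IH by blast
qed simp

lemma is_tree_unfold_tree:
  assumes c: "c \<in> C"
  shows "is_tree A (unfold_tree \<alpha> c)"
  unfolding is_tree_def
proof (intro conjI ballI allI impI)
  show "[] \<in> dom (unfold_tree \<alpha> c)" using coalg_Nil[OF c] unfold_tree_dom_iff[OF c run_Nil] by blast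
  show "v \<in> dom (unfold_tree \<alpha> c)" if "w \<in> dom (unfold_tree \<alpha> c)" "prefix v w" for w v
    using that unfold_tree_append[OF c] by (metis prefixE)
  show "\<exists>k. \<forall>i. w @ [i] \<in> dom (unfold_tree \<alpha> c) \<longleftrightarrow> i < k" if "w \<in> dom (unfold_tree \<alpha> c)" for w
  proof -
    obtain d v where r: "run \<alpha> c w = (d, v)" by fastforce
    then have "is_tree (insert Star (Label ` A)) (fst (\<alpha> d))" "v \<in> dom (fst (\<alpha> d))"
      using unfold_tree_dom_iff[OF c r] that run_state[OF c r] coalg_tree by auto
    then show ?thesis unfolding is_tree_def unfold_tree_children[OF c r] by blast
  qed
  show "ran (unfold_tree \<alpha> c) \<subseteq> A"
  proof
    fix a assume "a \<in> ran (unfold_tree \<alpha> c)"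
    then obtain w where w: "unfold_tree \<alpha> c w = Some a" by (auto simp: ran_def)
    obtain d v where r: "run \<alpha> c w = (d, v)" by fastforce
    then have "Label a \<in> ran (fst (\<alpha> d))" using unfold_tree_Some_iff[OF r] w by (auto simp: ran_def)
    then show "a \<in> A" using coalg_tree[of d] run_state[OF c r] by (auto simp: is_tree_def)
  qed
qed

section \<open>The unfolding is finite-fragmented\<close>

lemma unfold_rel_equiv: "equiv (dom (unfold_tree \<alpha> c)) (unfold_rel \<alpha> c)"
  by (intro equivI refl_onI symI transI) (auto simp: unfold_rel_def)

lemma sim_unfold: "sim (unfold_fft \<alpha> c) w v \<longleftrightarrow> (w, v) \<in> unfold_rel \<alpha> c"
  unfolding unfold_fft_def by (rule sim_quotient[OF unfold_rel_equiv])

lemma frag_root_idem: "frag_root \<alpha> c (frag_root \<alpha> c w) = frag_root \<alpha> c w"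
  using frag_root_run(2)[of \<alpha> c w] frag_root_eqI[of \<alpha> c "frag_root \<alpha> c w" "[]"]
  by (metis append_Nil2 prod.exhaust)

lemma prefix_frag_root: "prefix (frag_root \<alpha> c w) w"
  by (simp add: frag_root_def take_is_prefix)

lemma unfold_rel_frag_root:
  assumes "c \<in> C" "w \<in> dom (unfold_tree \<alpha> c)"
  shows "(w, frag_root \<alpha> c w) \<in> unfold_rel \<alpha> c"
proof -
  obtain v where "w = frag_root \<alpha> c w @ v" using prefix_frag_root[of c w] by (auto elim: prefixE)
  then have "frag_root \<alpha> c w \<in> dom (unfold_tree \<alpha> c)"
    using unfold_tree_append[OF assms(1)] assms(2) by metis
  with assms(2) show ?thesis by (simp add: unfold_rel_def frag_root_idem)
qed

lemma unfold_in_FFT: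
  assumes c: "c \<in> C"
  shows "unfold_fft \<alpha> c \<in> FFT A"
  unfolding unfold_fft_def
proof (rule FFT_quotientI[OF is_tree_unfold_tree[OF c] unfold_rel_equiv])
  fix w assume w: "w \<in> dom (unfold_tree \<alpha> c)"
  let ?r = "frag_root \<alpha> c w"
  obtain d v where r: "run \<alpha> c w = (d, v)" by fastforce
  \<comment> \<open>The entry prefix determines the element \<open>d\<close> entered there, so the
    block is contained in a shifted copy of the finite fragment of \<open>d\<close>.\<close>
  have "unfold_rel \<alpha> c `` {w} \<subseteq> (@) ?r ` dom (fst (\<alpha> d))"
  proof
    fix x assume "x \<in> unfold_rel \<alpha> c `` {w}"
    then have x: "x \<in> dom (unfold_tree \<alpha> c)" "frag_root \<alpha> c x = ?r" by (auto simp: unfold_rel_def)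
    obtain d' v' where r': "run \<alpha> c x = (d', v')" by fastforce
    have "d' = d" using frag_root_run(2)[OF r] frag_root_run(2)[OF r'] x(2) by simp
    then show "x \<in> (@) ?r ` dom (fst (\<alpha> d))"
      using frag_root_run(1)[OF r'] x unfold_tree_dom_iff[OF c r'] by auto
  qed
  moreover have "finite (dom (fst (\<alpha> d)))"
    using NWT_coalg[of d] run_state[OF c r] by (simp add: NWT_def)
  ultimately show "finite (unfold_rel \<alpha> c `` {w})" by (rule finite_surj[rotated])
  have "prefix ?r v" if "(w, v) \<in> unfold_rel \<alpha> c" for v
    using prefix_frag_root[of c v] that by (simp add: unfold_rel_def)
  then show "\<exists>m. (w, m) \<in> unfold_rel \<alpha> c \<and> (\<forall>v. (w, v) \<in> unfold_rel \<alpha> c \<longrightarrow> prefix m v)"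
    using unfold_rel_frag_root[OF c w] by blast
next
  fix w u v assume wv: "(w, v) \<in> unfold_rel \<alpha> c" and "prefix w u" "prefix u v"
  let ?r = "frag_root \<alpha> c v"
  obtain d v' where r: "run \<alpha> c v = (d, v')" by fastforce
  have "prefix ?r w" using wv prefix_frag_root[of c w] by (simp add: unfold_rel_def)
  then obtain u' where u: "u = ?r @ u'"
    using \<open>prefix w u\<close> prefix_order.trans by (metis prefixE)
  have v: "v = ?r @ v'" "run \<alpha> c ?r = (d, [])" using frag_root_run[OF r] by auto
  then have "prefix u' v'" using \<open>prefix u v\<close> u by (metis same_prefix_prefix)
  have d: "d \<in> C" "fst (\<alpha> d) v' \<noteq> Some Star" using run_state[OF c r] by auto
  have v': "v' \<in> dom (fst (\<alpha> d))" using unfold_tree_dom_iff[OF c r] wv by (auto simp: unfold_rel_def)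
  \<comment> \<open>Here \<open>u'\<close> is a prefix of the labelled position \<open>v'\<close>,
    so no \<open>Star\<close> is met on the way to \<open>u\<close> and the run is still in the
    fragment entered at \<open>?r\<close>.\<close>
  have "\<exists>a. fst (\<alpha> d) u' = Some (Label a)"
  proof (cases "u' = v'")
    case True
    then show ?thesis using d v' by (metis domD slabel.exhaust)
  next
    case False
    then show ?thesis using coalg_below[OF d(1), of v' _ u'] v' \<open>prefix u' v'\<close>
      by (auto simp: strict_prefix_def)
  qed
  then have "run \<alpha> c (?r @ u') = (d, u')" using run_Label[OF d(1)] run_append[OF v(2)] by auto
  then have "frag_root \<alpha> c u = ?r" using frag_root_eqI u by metis
  moreover have "u \<in> dom (unfold_tree \<alpha> c)"
    using unfold_tree_append[OF c] \<open>prefix u v\<close> wv by (auto simp: unfold_rel_def elim!: prefixE)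
  ultimately show "(w, u) \<in> unfold_rel \<alpha> c" using wv by (simp add: unfold_rel_def)
qed

section \<open>Destructing the unfolding gives back the coalgebra\<close>

lemma roots_unfold_iff:
  assumes c: "c \<in> C"
  shows "w \<in> roots (unfold_fft \<alpha> c) \<longleftrightarrow> w \<in> dom (unfold_tree \<alpha> c) \<and> frag_root \<alpha> c w = w"
proof -
  have "frag_root \<alpha> c w = w" if "w \<in> dom (unfold_tree \<alpha> c)" "\<forall>v. (w, v) \<in> unfold_rel \<alpha> c \<longrightarrow> prefix w v"
    using that unfold_rel_frag_root[OF c] prefix_frag_root prefix_order.antisym by metis
  moreover have "prefix w v" if "frag_root \<alpha> c w = w" "(w, v) \<in> unfold_rel \<alpha> c" for v
    using that prefix_frag_root[of c v] by (simp add: unfold_rel_def)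
  moreover have "fst (unfold_fft \<alpha> c) = unfold_tree \<alpha> c" by (simp add: unfold_fft_def)
  ultimately show ?thesis unfolding roots_iff[OF unfold_in_FFT[OF c]] sim_unfold by metis
qed

lemma Star_root_unfold:
  assumes c: "c \<in> C" and u: "fst (\<alpha> c) u = Some Star"
  shows "u \<in> roots (unfold_fft \<alpha> c)"
proof -
  have r: "run \<alpha> c u = (snd (\<alpha> c) u, [])" using run_Star[OF c u, of "[]"] by simp
  moreover have "u \<in> dom (unfold_tree \<alpha> c)"
    using unfold_tree_dom_iff[OF c r] coalg_Nil[OF coalg_Star[OF c u]] by auto
  ultimately show ?thesis unfolding roots_unfold_iff[OF c] by (simp add: frag_root_def)
qed

lemma sim_Nil_unfold_iff:
  assumes c: "c \<in> C"
  shows "sim (unfold_fft \<alpha> c) [] w \<longleftrightarrow> (\<exists>a. fst (\<alpha> c) w = Some (Label a))"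
proof
  assume "sim (unfold_fft \<alpha> c) [] w"
  then have w: "w \<in> dom (unfold_tree \<alpha> c)" "frag_root \<alpha> c w = []"
    by (auto simp: sim_unfold unfold_rel_def frag_root_def)
  obtain d v where r: "run \<alpha> c w = (d, v)" by fastforce
  \<comment> \<open>An empty entry prefix means that no switch has occurred, so the run is still in
    the initial fragment.\<close>
  have "d = c" "v = w" using frag_root_run[OF r] w by auto
  then show "\<exists>a. fst (\<alpha> c) w = Some (Label a)" using unfold_tree_Some_iff[OF r] w by auto
next
  assume "\<exists>a. fst (\<alpha> c) w = Some (Label a)"
  then obtain a where a: "fst (\<alpha> c) w = Some (Label a)" by blast
  then have "run \<alpha> c w = (c, w)" using run_Label c by blast
  moreover from this have "w \<in> dom (unfold_tree \<alpha> c)" using unfold_tree_dom_iff[OF c] a by blast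
  moreover from this have "[] \<in> dom (unfold_tree \<alpha> c)" using unfold_tree_append[OF c, of "[]"] by simp
  ultimately show "sim (unfold_fft \<alpha> c) [] w" by (simp add: sim_unfold unfold_rel_def frag_root_def)
qed

lemma tf_unfold:
  assumes c: "c \<in> C"
  shows "tf (unfold_fft \<alpha> c) [] = fst (\<alpha> c)"
proof
  fix w
  note F = unfold_in_FFT[OF c]
  \<comment> \<open>A labelled position of the fragment of \<open>c\<close> has entry prefix
    \<open>[]\<close>, so only \<open>[]\<close> itself can be a root among them.\<close>
  have no_root: "\<not> (u \<in> roots (unfold_fft \<alpha> c) \<and> u \<noteq> [])" if "fst (\<alpha> c) u = Some (Label a)" for u a
    using run_Label[OF c that] by (simp add: roots_unfold_iff[OF c] frag_root_def)
  consider a where "fst (\<alpha> c) w = Some (Label a)" | "fst (\<alpha> c) w = Some Star" | "fst (\<alpha> c) w = None"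
    by (metis option.exhaust slabel.exhaust)
  then show "tf (unfold_fft \<alpha> c) [] w = fst (\<alpha> c) w"
  proof cases
    case 1
    then have "fst (unfold_fft \<alpha> c) w = Some a"
      using unfold_tree_Some_iff[OF run_Label[OF c 1]] by (simp add: unfold_fft_def)
    then show ?thesis using 1 tf_Label_iff[OF F, of w a] sim_Nil_unfold_iff[OF c, of w] by auto
  next
    case 2
    have "\<not> (\<exists>u\<in>roots (unfold_fft \<alpha> c). u \<noteq> [] \<and> strict_prefix u w)"
      using coalg_below[OF c 2] no_root by blast
    then have "root_succ (unfold_fft \<alpha> c) [] w"
      using Star_root_unfold[OF c 2] coalg_Star_nonempty[OF c 2] by (simp add: root_succ_Nil_iff[OF F])
    then show ?thesis using 2 tf_Star_iff[OF F, of w] by simp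
  next
    case 3
    have "\<not> root_succ (unfold_fft \<alpha> c) [] w"
    proof
      assume s: "root_succ (unfold_fft \<alpha> c) [] w"
      then have w: "w \<in> dom (unfold_tree \<alpha> c)"
        by (simp add: root_succ_Nil_iff[OF F] roots_unfold_iff[OF c])
      \<comment> \<open>As \<open>w\<close> is a node of the unfolding but not of the fragment of
        \<open>c\<close>, its run must have met a \<open>Star\<close> at some \<open>u\<close>. That
        \<open>u\<close> is a nonempty root strictly above \<open>w\<close>, so \<open>w\<close> is
        not an immediate successor of the root.\<close>
      have "run \<alpha> c w \<noteq> (c, w)" using unfold_tree_dom_iff[OF c, of w c w] w 3 by auto
      then obtain u where u: "u \<noteq> []" "prefix u w" "fst (\<alpha> c) u = Some Star"
        using run_no_Star[of w \<alpha> c] by blast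
      then have "strict_prefix u w" using 3 by (auto simp: strict_prefix_def)
      then show False using s u Star_root_unfold[OF c u(3)] by (auto simp: root_succ_Nil_iff[OF F])
    qed
    moreover have "\<not> sim (unfold_fft \<alpha> c) [] w" using sim_Nil_unfold_iff[OF c, of w] 3 by simp
    ultimately have "w \<notin> dom (tf (unfold_fft \<alpha> c) [])" by (simp add: tf_dom_iff[OF F])
    then show ?thesis using 3 by auto
  qed
qed

lemma st_unfold:
  assumes c: "c \<in> C" and u: "fst (\<alpha> c) u = Some Star"
  shows "st (unfold_fft \<alpha> c) u = unfold_fft \<alpha> (snd (\<alpha> c) u)"
proof (rule FFT_eqI[of _ A])
  note F = unfold_in_FFT[OF c]
  show "st (unfold_fft \<alpha> c) u \<in> FFT A" using st_in_FFT[OF F] Star_root_unfold[OF c u] by blast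
  show "unfold_fft \<alpha> (snd (\<alpha> c) u) \<in> FFT A" using unfold_in_FFT coalg_Star[OF c u] by blast
  have tree: "unfold_tree \<alpha> c (u @ v) = unfold_tree \<alpha> (snd (\<alpha> c) u) v" for v
    by (simp add: unfold_tree_def run_Star[OF c u])
  then show "fst (st (unfold_fft \<alpha> c) u) = fst (unfold_fft \<alpha> (snd (\<alpha> c) u))"
    by (simp add: fun_eq_iff fst_st[OF F]) (simp add: unfold_fft_def)
  \<comment> \<open>Entry prefixes are merely shifted by \<open>u\<close>. Prepending
    \<open>u\<close> is injective, so equality of entry prefixes, and with it the block relation, is
    the same on both sides.\<close>
  have "frag_root \<alpha> c (u @ v) = u @ frag_root \<alpha> (snd (\<alpha> c) u) v" for v
  proof -
    obtain d x where r: "run \<alpha> (snd (\<alpha> c) u) v = (d, x)" by fastforce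
    then have "run \<alpha> c (u @ v) = (d, x)" by (simp add: run_Star[OF c u])
    moreover have v: "v = frag_root \<alpha> (snd (\<alpha> c) u) v @ x" using frag_root_run(1)[OF r] .
    ultimately show ?thesis using frag_root_eqI[of \<alpha> c "u @ frag_root \<alpha> (snd (\<alpha> c) u) v" x d]
      by (metis append.assoc)
  qed
  then show "sim (st (unfold_fft \<alpha> c) u) w v \<longleftrightarrow> sim (unfold_fft \<alpha> (snd (\<alpha> c) u)) w v" for w v
    by (simp add: sim_st[OF F] sim_unfold unfold_rel_def dom_def tree)
qed

section \<open>Homomorphisms into the finite-fragmented trees\<close>

lemma T_coalgebra_hom_FFT_iff:
  "T_coalgebra_hom C \<alpha> (FFT A) destruct f \<longleftrightarrow>
     f \<in> C \<rightarrow>\<^sub>E FFT A \<and>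
     (\<forall>c\<in>C. tf (f c) [] = fst (\<alpha> c) \<and>
        (\<forall>u. fst (\<alpha> c) u = Some Star \<longrightarrow> st (f c) u = f (snd (\<alpha> c) u)))"
proof -
  \<comment> \<open>Once the fragments agree, both continuation maps are extensional on the same set
    of \<open>Star\<close> leaves, so comparing them at those leaves suffices.\<close>
  have "destruct (f c) = T_map f (\<alpha> c) \<longleftrightarrow> tf (f c) [] = fst (\<alpha> c) \<and>
        (\<forall>u. fst (\<alpha> c) u = Some Star \<longrightarrow> st (f c) u = f (snd (\<alpha> c) u))" for c
    by (auto simp: destruct_def T_map_def compose_def nwleaf_def fun_eq_iff restrict_def
        split: prod.splits if_splits)
  then show ?thesis by (simp add: T_coalgebra_hom_def)
qed

lemma unfold_hom: "T_coalgebra_hom C \<alpha> (FFT A) destruct (restrict (unfold_fft \<alpha>) C)"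
  by (simp add: T_coalgebra_hom_FFT_iff unfold_in_FFT tf_unfold st_unfold coalg_Star)

text \<open>The pairs \<open>(f c, g c)\<close> form a bisimulation: both root fragments are that of
  \<open>\<alpha> c\<close>, and at a \<open>Star\<close> leaf both subtrees are the images of the
  same continuation \<open>snd (\<alpha> c) u\<close>.\<close>

lemma hom_unique:
  assumes f: "T_coalgebra_hom C \<alpha> (FFT A) destruct f" and g: "T_coalgebra_hom C \<alpha> (FFT A) destruct g"
  shows "f = g"
proof (rule PiE_ext)
  show "f \<in> C \<rightarrow>\<^sub>E FFT A" "g \<in> C \<rightarrow>\<^sub>E FFT A" using f g by (simp_all add: T_coalgebra_hom_FFT_iff)
  fix c assume "c \<in> C"
  then show "f c = g c"
  proof (intro FFT_coinduct[of "\<lambda>\<pi> \<rho>. \<exists>c\<in>C. \<pi> = f c \<and> \<rho> = g c" _ _ A], blast)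
    show "\<exists>c\<in>C. st \<pi> u = f c \<and> st \<rho> u = g c"
      if R: "\<exists>c\<in>C. \<pi> = f c \<and> \<rho> = g c" and u: "tf \<pi> [] u = Some Star" for \<pi> \<rho> u
    proof -
      obtain c where c: "c \<in> C" "\<pi> = f c" "\<rho> = g c" using R by blast
      then have "fst (\<alpha> c) u = Some Star" using u f by (simp add: T_coalgebra_hom_FFT_iff)
      with c f g show ?thesis
        by (intro bexI[of _ "snd (\<alpha> c) u"]) (simp_all add: T_coalgebra_hom_FFT_iff coalg_Star)
    qed
  qed (use f g in \<open>auto simp: T_coalgebra_hom_FFT_iff\<close>)
qed

end

theorem theorem2p19:
  fixes A :: "'a set"
  shows "T_coalgebra A (FFT A) destruct \<and>
    (\<forall>(C :: 'c set) \<alpha>. T_coalgebra A C \<alpha> \<longrightarrow>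
       (\<exists>!f. T_coalgebra_hom C \<alpha> (FFT A) destruct f))"
proof (intro conjI allI impI)
  show "T_coalgebra A (FFT A) destruct"
    unfolding T_coalgebra_def using destruct_in_T_obj by blast
  show "\<exists>!f. T_coalgebra_hom C \<alpha> (FFT A) destruct f" if "T_coalgebra A C \<alpha>"
    for C :: "'c set" and \<alpha>
    using unfold_hom[OF that] hom_unique[OF that] by blast
qed

end
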